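(* Let $X$ be a set with a distinguished element $0 \in X$. Let $G$ be a graph with $n \ge 3$ nodes, with edge weights $g_{\{i,j\}} \in X$ and node weights $w_i = g_{\{i,i\}} \in X$. Write $$P := \{\{i,j\} \mid 1 \le i < j \le n\}, \qquad E := \{S \in P \mid g_T \ne g_S \text{ for all } T \in P \setminus \{S\}\}.$$ Assume that for every $\{i,j\} \in P$ at least one of the following conditions holds: (i) $\{i,j\} \in E$; (ii) there exists $k \in \{1,\ldots,n\} \setminus \{i,j\}$ such that $\{i,k\} \in E$ and $\{j,k\} \in E$; (iii) $g_{\{i,j\}} = 0$. Then $G$ is reconstructible from the distribution of subtriangles; that is, every graph $G'$ with $n$ nodes and weights in $X$ such that $\mathcal{T}_{G'} = \mathcal{T}_G$ is isomorphic to $G$.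
   Context: A graph $G$ with $n$ nodes and weights in a set $X$ is a function assigning to each subset $\{i,j\} \subseteq \{1,\ldots,n\}$ (with $i=j$ allowed) an element $g_{\{i,j\}} \in X$; no further conditions are imposed. The value $w_i := g_{\{i,i\}}$ is called the weight of node $i$. Two graphs $G, G'$ with $n$ nodes and weights $g_{\{i,j\}}$, $g'_{\{i,j\}}$ in the same set $X$ are isomorphic if there is a permutation $\pi \in S_n$ with $g'_{\{i,j\}} = g_{\{\pi(i),\pi(j)\}}$ for all $i,j \in \{1,\ldots,n\}$ (including $i=j$). A multiset is a set together with a function assigning to each element a positive integer multiplicity; two multisets are equal if their underlying sets and multiplicity functions agree. For $n \ge 3$ and pairwise distinct $i,j,k \in \{1,\ldots,n\}$, the subtriangle $\mathfrak{t}_{\{i,j,k\}}$ is the multiset consisting of the three ordered pairs $(g_{\{i,j\}}, w_k)$, $(g_{\{i,k\}}, w_j)$, $(g_{\{j,k\}}, w_i) \in X \times X$. The distribution of subtriangles $\mathcal{T}_G$ of $G$ is the multiset consisting of all $\mathfrak{t}_S$ for $S \subseteq \{1,\ldots,n\}$ with $|S| = 3$ (counted with multiplicity). *)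

theory Defs
  imports Main "HOL-Library.Multiset" "HOL-Library.FuncSet" "HOL-Combinatorics.Permutations"
begin

text \<open>
  A graph on the nodes \<open>1, \<dots>, n\<close> is given by a weight function on sets of nodes, of which only the
  values at the sets \<open>{i, j}\<close> (with \<open>i = j\<close> allowed) matter; no notion below looks at any other value.
\<close>

definition node_pairs :: "nat \<Rightarrow> nat set set"
  where "node_pairs n = {{i, j} | i j. i \<in> {1..n} \<and> j \<in> {1..n}}"

definition weighted_graphs :: "nat \<Rightarrow> 'a set \<Rightarrow> (nat set \<Rightarrow> 'a) set"
  where "weighted_graphs n X = node_pairs n \<rightarrow> X"

definition node_weight :: "(nat set \<Rightarrow> 'a) \<Rightarrow> nat \<Rightarrow> 'a"
  where "node_weight g i = g {i, i}"

definition isomorphic :: "nat \<Rightarrow> (nat set \<Rightarrow> 'a) \<Rightarrow> (nat set \<Rightarrow> 'a) \<Rightarrow> bool"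
  where "isomorphic n g g' \<longleftrightarrow>
    (\<exists>p. p permutes {1..n} \<and> (\<forall>i\<in>{1..n}. \<forall>j\<in>{1..n}. g' {i, j} = g {p i, p j}))"

text \<open>
  The subtriangle is indexed by its node set \<open>S\<close>, so that no order of the nodes has to be chosen:
  each node of \<open>S\<close> contributes the weight of the opposite side together with its own weight. It is
  used for \<open>card S = 3\<close> only, where \<open>subtriangle_insert\<close> writes out its three elements.
\<close>

definition subtriangle :: "(nat set \<Rightarrow> 'a) \<Rightarrow> nat set \<Rightarrow> ('a \<times> 'a) multiset"
  where "subtriangle g S = {#(g (S - {k}), node_weight g k). k \<in># mset_set S#}"

lemma subtriangle_insert:
  assumes "i \<noteq> j" "i \<noteq> k" "j \<noteq> k"
  shows "subtriangle g {i, j, k} =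
    {#(g {i, j}, node_weight g k), (g {i, k}, node_weight g j), (g {j, k}, node_weight g i)#}"
proof -
  have "{i, j, k} - {i} = {j, k}" "{i, j, k} - {j} = {i, k}" "{i, j, k} - {k} = {i, j}"
    using assms by auto
  then show ?thesis
    using assms by (simp add: subtriangle_def)
qed

definition subtriangle_distribution :: "nat \<Rightarrow> (nat set \<Rightarrow> 'a) \<Rightarrow> ('a \<times> 'a) multiset multiset"
  where "subtriangle_distribution n g =
    {#subtriangle g S. S \<in># mset_set {S. S \<subseteq> {1..n} \<and> card S = 3}#}"

definition reconstructible :: "nat \<Rightarrow> 'a set \<Rightarrow> (nat set \<Rightarrow> 'a) \<Rightarrow> bool"
  where "reconstructible n X g \<longleftrightarrow>
    (\<forall>g' \<in> weighted_graphs n X.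
       subtriangle_distribution n g' = subtriangle_distribution n g \<longrightarrow> isomorphic n g g')"

definition edges :: "nat \<Rightarrow> nat set set"
  where "edges n = {{i, j} | i j. 1 \<le> i \<and> i < j \<and> j \<le> n}"

definition unique_edges :: "nat \<Rightarrow> (nat set \<Rightarrow> 'a) \<Rightarrow> nat set set"
  where "unique_edges n g = {S \<in> edges n. \<forall>T \<in> edges n - {S}. g T \<noteq> g S}"

end

theory Submission
  imports Defs
begin

text \<open>
  Call a weight unique if exactly one edge carries it. Everything rests on two kinds of information
  in the subtriangles. Globally, every edge lies in \<open>n - 2\<close> triangles and every node in a constant
  number of them, so the multisets of edge weights and of node weights can be read off; hence so can
  the set of unique weights. Locally, for each triangle of \<open>g\<close> there is a triangle of \<open>g'\<close> with the
  same six weights in matching positions (\<open>transport_triangle\<close>), and an edge of unique weight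
  leaves no choice for where its copy lies.

  The unique weights give a bijection between the unique edges of \<open>g\<close> and of \<open>g'\<close>, but it must be
  shown to come from a map of nodes, as in Whitney's theorem on line graphs: two adjacent edges are
  mapped to adjacent edges, and the danger is that a star of three edges becomes a triangle.
  Subtriangles exclude this, because they reveal whether three unique edges form a triangle.
  Rather than building the node map along connected components, each node \<open>i\<close> is given a type:
  the set of unique weights on edges at \<open>i\<close>, together with the weight of \<open>i\<close>.
  The ends of a unique edge have the same two types in both graphs (\<open>edge_types\<close>); nodes on no
  unique edge are then accounted for by the multiset of all node weights. So the multisets of types
  agree (\<open>node_types_cong\<close>), and some permutation of the nodes preserves types.

  Such a permutation carries unique edges to unique edges of the same weight, since a unique edge is
  determined by the two nodes whose types contain its weight. Two adjacent unique edges determine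
  their triangle, so the weight of its third side is preserved as well. By hypothesis the edges not
  reached in this way all have the weight \<open>z\<close> in \<open>g\<close>; comparing the number of edges of weight
  \<open>z\<close> shows that they have it in \<open>g'\<close> too.
\<close>

section \<open>Edges, stars and node types\<close>

definition edge_weights :: "nat \<Rightarrow> (nat set \<Rightarrow> 'a) \<Rightarrow> 'a multiset"
  where "edge_weights n g = image_mset g (mset_set (edges n))"

definition node_weights :: "nat \<Rightarrow> (nat set \<Rightarrow> 'a) \<Rightarrow> 'a multiset"
  where "node_weights n g = image_mset (node_weight g) (mset_set {1..n})"

definition unique_weights :: "nat \<Rightarrow> (nat set \<Rightarrow> 'a) \<Rightarrow> 'a set"
  where "unique_weights n g = {x. count (edge_weights n g) x = 1}"

definition star :: "nat \<Rightarrow> (nat set \<Rightarrow> 'a) \<Rightarrow> nat \<Rightarrow> 'a set"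
  where "star n g i = {x \<in> unique_weights n g. \<exists>j \<in> {1..n} - {i}. g {i, j} = x}"

text \<open>
  A unique edge is encoded by its weight, so that node types of different graphs can be compared
  directly, without a bijection between their unique edges.
\<close>

definition node_type :: "nat \<Rightarrow> (nat set \<Rightarrow> 'a) \<Rightarrow> nat \<Rightarrow> 'a set \<times> 'a"
  where "node_type n g i = (star n g i, node_weight g i)"

lemma edges_eq_card_2: "edges n = {S. S \<subseteq> {1..n} \<and> card S = 2}"
proof (intro equalityI subsetI CollectI)
  fix S assume "S \<in> edges n"
  then show "S \<subseteq> {1..n} \<and> card S = 2"
    by (auto simp: edges_def)
next
  fix S assume "S \<in> {S. S \<subseteq> {1..n} \<and> card S = 2}"
  then obtain i j where ij: "S = {i, j}" "i \<noteq> j" "i \<in> {1..n}" "j \<in> {1..n}"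
    by (auto simp: card_2_iff)
  from \<open>i \<noteq> j\<close> consider "i < j" | "j < i" by linarith
  then show "S \<in> edges n"
  proof cases
    case 1
    then show ?thesis unfolding edges_def using ij by auto
  next
    case 2
    have "S = {j, i}" using ij(1) by (simp only: insert_commute)
    then show ?thesis unfolding edges_def using 2 ij(3,4) by auto
  qed
qed

lemma doubleton_in_edges_iff [simp]:
  "{i, j} \<in> edges n \<longleftrightarrow> i \<in> {1..n} \<and> j \<in> {1..n} \<and> i \<noteq> j"
  by (auto simp: edges_eq_card_2 card_insert_if)

lemma finite_edges [simp]: "finite (edges n)"
  by (simp add: edges_eq_card_2)

section \<open>Edge and node weights are determined by the subtriangles\<close>

text \<open>
  A triple of nodes with a distinguished member is the same as a node together with an edge that
  avoids it. This turns every count over subtriangles into a count over pairs of an edge and a node.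
\<close>

lemma sum_triples_eq_sum_flags:
  fixes f :: "nat set \<Rightarrow> nat \<Rightarrow> 'b::comm_monoid_add"
  shows "(\<Sum>S | S \<subseteq> {1..n} \<and> card S = 3. \<Sum>k\<in>S. f (S - {k}) k) =
         (\<Sum>k\<in>{1..n}. \<Sum>e | e \<subseteq> {1..n} - {k} \<and> card e = 2. f e k)"
proof -
  have fin: "finite S" if "S \<subseteq> {1..n}" for S :: "nat set"
    using that by (rule finite_subset) simp
  have card_insert: "card (insert k e) = 3" if "e \<subseteq> {1..n} - {k}" "card e = 2" for k e
  proof -
    have "finite e" "k \<notin> e" using that(1) fin[of e] by auto
    then show ?thesis using that(2) by simp
  qed
  have "(\<Sum>S | S \<subseteq> {1..n} \<and> card S = 3. \<Sum>k\<in>S. f (S - {k}) k) =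
        (\<Sum>(S, k)\<in>Sigma {S. S \<subseteq> {1..n} \<and> card S = 3} (\<lambda>S. S). f (S - {k}) k)"
    by (rule sum.Sigma) (auto simp: fin)
  also have "\<dots> = (\<Sum>(k, e)\<in>Sigma {1..n} (\<lambda>k. {e. e \<subseteq> {1..n} - {k} \<and> card e = 2}). f e k)"
    by (rule sum.reindex_bij_witness
          [where i = "\<lambda>(k, e). (insert k e, k)" and j = "\<lambda>(S, k). (k, S - {k})"])
       (auto simp: insert_absorb fin card_insert)
  also have "\<dots> = (\<Sum>k\<in>{1..n}. \<Sum>e | e \<subseteq> {1..n} - {k} \<and> card e = 2. f e k)"
    by (rule sum.Sigma [symmetric]) auto
  finally show ?thesis .
qed

lemma sum_mset_subtriangle_distribution:
  "\<Sum>\<^sub># (subtriangle_distribution n g) =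
    (\<Sum>k\<in>{1..n}. \<Sum>e | e \<subseteq> {1..n} - {k} \<and> card e = 2. {#(g e, node_weight g k)#})"
proof -
  have "subtriangle g S = (\<Sum>k\<in>S. {#(g (S - {k}), node_weight g k)#})" for S
    unfolding subtriangle_def by (simp add: sum_unfold_sum_mset)
  then show ?thesis
    unfolding subtriangle_distribution_def
    using sum_triples_eq_sum_flags[where n = n and f = "\<lambda>e k. {#(g e, node_weight g k)#}"]
    by (simp flip: sum_unfold_sum_mset)
qed

lemma image_mset_sum: "finite A \<Longrightarrow> image_mset f (sum F A) = (\<Sum>a\<in>A. image_mset f (F a))"
  by (induction A rule: finite_induct) auto

lemma count_image_eq_sum:
  "finite A \<Longrightarrow> count (image_mset f (mset_set A)) x = (\<Sum>a\<in>A. if f a = x then 1 else 0)"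
  by (induction A rule: finite_induct) auto

text \<open>A node is opposite to one edge for each pair of other nodes.\<close>

lemma node_weights_from_subtriangles:
  "image_mset snd (\<Sum>\<^sub># (subtriangle_distribution n g)) =
    repeat_mset ((n - 1) choose 2) (node_weights n g)"
proof (rule multiset_eqI)
  fix x
  have c: "card {e. e \<subseteq> {1..n} - {k} \<and> card e = 2} = (n - 1) choose 2" if "k \<in> {1..n}" for k
    using that n_subsets[of "{1..n} - {k}" 2] by simp
  have "count (image_mset snd (\<Sum>\<^sub># (subtriangle_distribution n g))) x =
      (\<Sum>k\<in>{1..n}. card {e. e \<subseteq> {1..n} - {k} \<and> card e = 2} *
        (if node_weight g k = x then 1 else 0))"
    unfolding sum_mset_subtriangle_distribution
    by (simp add: image_mset_sum count_sum cong: if_cong)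
  also have "\<dots> = (\<Sum>k\<in>{1..n}. ((n - 1) choose 2) * (if node_weight g k = x then 1 else 0))"
    by (rule sum.cong) (use c in auto)
  also have "\<dots> = count (repeat_mset ((n - 1) choose 2) (node_weights n g)) x"
    by (simp add: node_weights_def count_image_eq_sum sum_distrib_left)
  finally show "count (image_mset snd (\<Sum>\<^sub># (subtriangle_distribution n g))) x =
      count (repeat_mset ((n - 1) choose 2) (node_weights n g)) x" .
qed

text \<open>An edge is opposite to each of the \<open>n - 2\<close> nodes off it.\<close>

lemma edge_weights_from_subtriangles:
  "image_mset fst (\<Sum>\<^sub># (subtriangle_distribution n g)) = repeat_mset (n - 2) (edge_weights n g)"
proof (rule multiset_eqI)
  fix x
  have c: "card ({1..n} - e) = n - 2" if "e \<in> edges n" for e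
    using that by (auto simp: edges_eq_card_2 card_Diff_subset finite_subset)
  have "count (image_mset fst (\<Sum>\<^sub># (subtriangle_distribution n g))) x =
      (\<Sum>k\<in>{1..n}. \<Sum>e | e \<subseteq> {1..n} - {k} \<and> card e = 2. if g e = x then 1 else 0)"
    unfolding sum_mset_subtriangle_distribution
    by (simp add: image_mset_sum count_sum cong: if_cong)
  also have "\<dots> = (\<Sum>k\<in>{1..n}. \<Sum>e | e \<in> edges n \<and> k \<notin> e. if g e = x then 1 else 0)"
    by (rule sum.cong, simp, rule sum.cong) (auto simp: edges_eq_card_2)
  also have "\<dots> = (\<Sum>e\<in>edges n. \<Sum>k | k \<in> {1..n} \<and> k \<notin> e. if g e = x then 1 else 0)"
    by (rule sum.swap_restrict) auto
  also have "\<dots> = (\<Sum>e\<in>edges n. (n - 2) * (if g e = x then 1 else 0))"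
  proof (rule sum.cong)
    fix e assume "e \<in> edges n"
    then show "(\<Sum>k | k \<in> {1..n} \<and> k \<notin> e. if g e = x then 1 else 0) =
        (n - 2) * (if g e = x then 1 else 0 :: nat)"
      using c by (simp add: set_diff_eq)
  qed simp
  also have "\<dots> = count (repeat_mset (n - 2) (edge_weights n g)) x"
    by (simp add: edge_weights_def count_image_eq_sum sum_distrib_left)
  finally show "count (image_mset fst (\<Sum>\<^sub># (subtriangle_distribution n g))) x =
      count (repeat_mset (n - 2) (edge_weights n g)) x" .
qed

lemma edge_weights_cong:
  assumes "subtriangle_distribution n g = subtriangle_distribution n g'" "n \<ge> 3"
  shows "edge_weights n g = edge_weights n g'"
  using edge_weights_from_subtriangles[of n g] edge_weights_from_subtriangles[of n g'] assms
  by (simp add: repeat_mset_cancel1)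

lemma node_weights_cong:
  assumes "subtriangle_distribution n g = subtriangle_distribution n g'" "n \<ge> 3"
  shows "node_weights n g = node_weights n g'"
proof -
  have "(n - 1) choose 2 \<noteq> 0"
    using assms(2) by (simp add: binomial_eq_0_iff)
  then show ?thesis
    using node_weights_from_subtriangles[of n g] node_weights_from_subtriangles[of n g'] assms
    by (simp add: repeat_mset_cancel1)
qed

lemma unique_weights_cong:
  assumes "subtriangle_distribution n g = subtriangle_distribution n g'" "n \<ge> 3"
  shows "unique_weights n g = unique_weights n g'"
  using edge_weights_cong[OF assms] by (simp add: unique_weights_def)

lemma count_edge_weights: "count (edge_weights n g) x = card {S \<in> edges n. g S = x}"
proof -
  have "g -` {x} \<inter> edges n = {S \<in> edges n. g S = x}" by auto
  then show ?thesis
    by (simp add: edge_weights_def count_image_mset)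
qed

lemma unique_weightE:
  assumes "x \<in> unique_weights n g"
  obtains R where "{S \<in> edges n. g S = x} = {R}"
proof -
  have "card {S \<in> edges n. g S = x} = 1"
    using assms by (simp add: unique_weights_def count_edge_weights)
  then show thesis using that by (rule card_1_singletonE)
qed

lemma unique_weightD:
  assumes "x \<in> unique_weights n g" "S \<in> edges n" "g S = x" "T \<in> edges n" "g T = x"
  shows "S = T"
proof -
  obtain R where R: "{S \<in> edges n. g S = x} = {R}"
    using assms(1) by (rule unique_weightE)
  have "S \<in> {S \<in> edges n. g S = x}" "T \<in> {S \<in> edges n. g S = x}"
    using assms by simp_all
  then show ?thesis unfolding R by simp
qed

lemma edgeE:
  assumes "S \<in> edges n"
  obtains i j where "S = {i, j}" "i \<in> {1..n}" "j \<in> {1..n}" "i \<noteq> j"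
proof -
  obtain i j where "S = {i, j}" "1 \<le> i" "i < j" "j \<le> n"
    using assms unfolding edges_def by blast
  then show thesis using that[of i j] by simp
qed

lemma unique_weight_edgeE:
  assumes "x \<in> unique_weights n g"
  obtains i j where "i \<in> {1..n}" "j \<in> {1..n}" "i \<noteq> j" "g {i, j} = x"
proof -
  obtain R where "{S \<in> edges n. g S = x} = {R}"
    using assms by (rule unique_weightE)
  then have "R \<in> edges n" "g R = x" by blast+
  then show ?thesis using that by (elim edgeE) simp
qed

lemma unique_edge_weight:
  assumes "S \<in> unique_edges n g"
  shows "g S \<in> unique_weights n g"
proof -
  have "{T \<in> edges n. g T = g S} = {S}"
    using assms by (auto simp: unique_edges_def)
  then show ?thesis by (simp add: unique_weights_def count_edge_weights)
qed

lemma starI: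
  "g {i, j} \<in> unique_weights n g \<Longrightarrow> j \<in> {1..n} \<Longrightarrow> i \<noteq> j \<Longrightarrow> g {i, j} \<in> star n g i"
  by (auto simp: star_def)

lemma starE:
  assumes "x \<in> star n g i"
  obtains j where "j \<in> {1..n}" "j \<noteq> i" "g {i, j} = x" "x \<in> unique_weights n g"
  using assms unfolding star_def by blast

section \<open>Transporting triangles\<close>

lemma mset_3_eqE:
  assumes "{#a, b, c#} = {#d, e, f#}"
  obtains "a = d" "b = e" "c = f" | "a = d" "b = f" "c = e" | "a = e" "b = d" "c = f"
    | "a = e" "b = f" "c = d" | "a = f" "b = d" "c = e" | "a = f" "b = e" "c = d"
  using assms by (auto simp: add_eq_conv_ex)

text \<open>
  A subtriangle lists each side with its opposite node, so matching its three pairs with those of an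
  equal subtriangle matches the nodes of the two triangles compatibly with all weights.
\<close>

lemma transport_triangle:
  assumes T: "subtriangle_distribution n g = subtriangle_distribution n g'"
    and ijk: "i \<in> {1..n}" "j \<in> {1..n}" "k \<in> {1..n}" "i \<noteq> j" "i \<noteq> k" "j \<noteq> k"
  obtains i' j' k' where "i' \<in> {1..n}" "j' \<in> {1..n}" "k' \<in> {1..n}" "i' \<noteq> j'" "i' \<noteq> k'" "j' \<noteq> k'"
    "g' {i', j'} = g {i, j}" "g' {i', k'} = g {i, k}" "g' {j', k'} = g {j, k}"
    "node_weight g' i' = node_weight g i" "node_weight g' j' = node_weight g j"
    "node_weight g' k' = node_weight g k"
proof -
  have fin: "finite {S. S \<subseteq> {1..n} \<and> card S = 3}" by simp
  have "{i, j, k} \<in> {S. S \<subseteq> {1..n} \<and> card S = 3}"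
    using ijk by simp
  then have "subtriangle g {i, j, k} \<in># subtriangle_distribution n g"
    unfolding subtriangle_distribution_def using fin by (auto intro!: imageI)
  then have "subtriangle g {i, j, k} \<in># subtriangle_distribution n g'"
    using T by simp
  then obtain S where S: "S \<subseteq> {1..n}" "card S = 3" "subtriangle g {i, j, k} = subtriangle g' S"
    unfolding subtriangle_distribution_def using fin by auto
  then obtain a b c where abc: "S = {a, b, c}" "a \<noteq> b" "a \<noteq> c" "b \<noteq> c"
    by (auto simp: card_3_iff)
  have N: "a \<in> {1..n}" "b \<in> {1..n}" "c \<in> {1..n}" using S(1) abc(1) by auto
  have E: "{#(g {i, j}, node_weight g k), (g {i, k}, node_weight g j), (g {j, k}, node_weight g i)#} =
    {#(g' {a, b}, node_weight g' c), (g' {a, c}, node_weight g' b), (g' {b, c}, node_weight g' a)#}"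
    using S(3) unfolding abc(1) subtriangle_insert[OF ijk(4-6)] subtriangle_insert[OF abc(2-4)] .
  note flip = insert_commute[of _ _ "{}"]
  from E show thesis
  proof (cases rule: mset_3_eqE)
    case 1 then show thesis using that[OF N(1,2,3)] abc(2-4) by simp
  next
    case 2 then show thesis using that[OF N(2,1,3)] abc(2-4) flip[of a b] by simp
  next
    case 3 then show thesis using that[OF N(1,3,2)] abc(2-4) flip[of b c] by simp
  next
    case 4 then show thesis using that[OF N(3,1,2)] abc(2-4) flip[of a c] flip[of b c] by simp
  next
    case 5 then show thesis using that[OF N(2,3,1)] abc(2-4) flip[of a b] flip[of a c] by simp
  next
    case 6 then show thesis
      using that[OF N(3,2,1)] abc(2-4) flip[of a b] flip[of a c] flip[of b c] by simp
  qed
qed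

section \<open>Types at the ends of a unique edge\<close>

text \<open>
  Stars go to stars: let \<open>i\<close> lie on the unique edges \<open>{i, j}\<close> and \<open>{i, k}\<close>, and let \<open>{i, l}\<close> be a
  third unique edge. Transporting the triangles \<open>{i, j, l}\<close> and \<open>{i, k, l}\<close> shows that the copy of
  \<open>{i, l}\<close> meets the copies \<open>{i', j'}\<close> and \<open>{i', k'}\<close> of the first two. If it missed \<open>i'\<close>, it would
  be \<open>{j', k'}\<close>, and \<open>{j, k}\<close> would have the weight of \<open>{i, l}\<close>, which only one edge carries.
\<close>

lemma star_subset_at_common_node:
  assumes T: "subtriangle_distribution n g = subtriangle_distribution n g'" and n: "n \<ge> 3"
    and ijk: "i \<in> {1..n}" "j \<in> {1..n}" "k \<in> {1..n}" "i \<noteq> j" "i \<noteq> k" "j \<noteq> k"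
    and ijk': "i' \<in> {1..n}" "j' \<in> {1..n}" "k' \<in> {1..n}" "i' \<noteq> j'" "i' \<noteq> k'" "j' \<noteq> k'"
    and g: "g' {i', j'} = g {i, j}" "g' {i', k'} = g {i, k}" "g' {j', k'} = g {j, k}"
    and U: "g {i, j} \<in> unique_weights n g" "g {i, k} \<in> unique_weights n g"
  shows "star n g i \<subseteq> star n g' i'"
proof
  fix u assume "u \<in> star n g i"
  then obtain l where l: "l \<in> {1..n}" "l \<noteq> i" "g {i, l} = u" and u: "u \<in> unique_weights n g"
    by (rule starE)
  note UU = unique_weights_cong[OF T n]
  note U' = U[unfolded UU] and u' = u[unfolded UU]
  show "u \<in> star n g' i'"
  proof (cases "l = j \<or> l = k")
    case True
    then show ?thesis
      using starI[of g' i' j' n] starI[of g' i' k' n] g l U' ijk' by auto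
  next
    case False
    obtain i2 j2 l2 where t2: "i2 \<in> {1..n}" "j2 \<in> {1..n}" "l2 \<in> {1..n}" "i2 \<noteq> j2" "i2 \<noteq> l2" "j2 \<noteq> l2"
      "g' {i2, j2} = g {i, j}" "g' {i2, l2} = u"
      using transport_triangle[OF T, of i j l] l False ijk by metis
    obtain i3 k3 l3 where t3: "i3 \<in> {1..n}" "k3 \<in> {1..n}" "l3 \<in> {1..n}" "i3 \<noteq> k3" "i3 \<noteq> l3" "k3 \<noteq> l3"
      "g' {i3, k3} = g {i, k}" "g' {i3, l3} = u"
      using transport_triangle[OF T, of i k l] l False ijk by metis
    (* The copies of {i, j} and {i, k} are known as sets, but their ends may be exchanged. *)
    have "{i2, j2} = {i', j'}"
      using unique_weightD[OF U'(1)] t2 ijk' g by simp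
    moreover have "{i3, k3} = {i', k'}"
      using unique_weightD[OF U'(2)] t3 ijk' g by simp
    ultimately consider "i2 = i'" | "i3 = i'" | "i2 = j'" "i3 = k'"
      by (auto simp: doubleton_eq_iff)
    then show ?thesis
    proof cases
      case 1
      then show ?thesis using t2 u' starI[of g' i' l2 n] by simp
    next
      case 2
      then show ?thesis using t3 u' starI[of g' i' l3 n] by simp
    next
      case 3
      have "{i2, l2} = {i3, l3}"
        using unique_weightD[OF u'] t2 t3 by simp
      then have "{i2, l2} = {j', k'}"
        using 3 ijk' by (auto simp: doubleton_eq_iff)
      then have "g {j, k} = u"
        using g t2 by simp
      then have "{i, l} = {j, k}"
        using unique_weightD[OF u] l ijk by simp
      then show ?thesis
        using ijk by (auto simp: doubleton_eq_iff)
    qed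
  qed
qed

text \<open>
  An edge \<open>{j, l}\<close> with \<open>l \<noteq> i\<close> meets \<open>{i, j}\<close> but does not contain \<open>i\<close>. Its copy therefore meets
  \<open>{i', j'}\<close>, and it cannot contain \<open>i'\<close> once the star of \<open>i'\<close> is known to come from that of \<open>i\<close>.
\<close>

lemma star_subset_at_other_node:
  assumes T: "subtriangle_distribution n g = subtriangle_distribution n g'" and n: "n \<ge> 3"
    and ij: "i \<in> {1..n}" "j \<in> {1..n}" "i \<noteq> j"
    and ij': "i' \<in> {1..n}" "j' \<in> {1..n}" "i' \<noteq> j'"
    and g: "g' {i', j'} = g {i, j}"
    and U: "g {i, j} \<in> unique_weights n g"
    and sub: "star n g' i' \<subseteq> star n g i"
  shows "star n g j \<subseteq> star n g' j'"
proof
  fix u assume "u \<in> star n g j"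
  then obtain l where l: "l \<in> {1..n}" "l \<noteq> j" "g {j, l} = u" and u: "u \<in> unique_weights n g"
    by (rule starE)
  note UU = unique_weights_cong[OF T n]
  note U' = U[unfolded UU] and u' = u[unfolded UU]
  show "u \<in> star n g' j'"
  proof (cases "l = i")
    case True
    then show ?thesis
      using starI[of g' j' i' n] g l U' ij' by (auto simp: insert_commute)
  next
    case False
    obtain i2 j2 l2 where t2: "i2 \<in> {1..n}" "j2 \<in> {1..n}" "l2 \<in> {1..n}" "i2 \<noteq> j2" "i2 \<noteq> l2" "j2 \<noteq> l2"
      "g' {i2, j2} = g {i, j}" "g' {j2, l2} = u"
      using transport_triangle[OF T, of i j l] l False ij by metis
    have "{i2, j2} = {i', j'}"
      using unique_weightD[OF U'] t2 ij' g by simp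
    then consider "j2 = j'" | "j2 = i'"
      by (auto simp: doubleton_eq_iff)
    then show ?thesis
    proof cases
      case 1
      then show ?thesis using t2 u' starI[of g' j' l2 n] by simp
    next
      case 2
      then have "u \<in> star n g i"
        using t2 u' starI[of g' i' l2 n] sub by auto
      then obtain m where "m \<in> {1..n}" "m \<noteq> i" "g {i, m} = u"
        by (rule starE)
      then have "{i, m} = {j, l}"
        using unique_weightD[OF u] l ij by simp
      then show ?thesis
        using ij False by (auto simp: doubleton_eq_iff)
    qed
  qed
qed

text \<open>
  A second unique edge at \<open>i\<close> tells the two ends of \<open>{i, j}\<close> apart: one triangle containing both
  edges fixes the images of \<open>i\<close> and \<open>j\<close>, and the two preceding lemmas, used in both directions,
  compare the stars there.
\<close>

lemma edge_types_if_adjacent_edge: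
  assumes T: "subtriangle_distribution n g = subtriangle_distribution n g'" and n: "n \<ge> 3"
    and ijk: "i \<in> {1..n}" "j \<in> {1..n}" "k \<in> {1..n}" "i \<noteq> j" "i \<noteq> k" "j \<noteq> k"
    and ij': "i' \<in> {1..n}" "j' \<in> {1..n}" "i' \<noteq> j'"
    and g: "g' {i', j'} = g {i, j}"
    and U: "g {i, j} \<in> unique_weights n g" "g {i, k} \<in> unique_weights n g"
  shows "{#node_type n g i, node_type n g j#} = {#node_type n g' i', node_type n g' j'#}"
proof -
  obtain a b c where t: "a \<in> {1..n}" "b \<in> {1..n}" "c \<in> {1..n}" "a \<noteq> b" "a \<noteq> c" "b \<noteq> c"
    "g' {a, b} = g {i, j}" "g' {a, c} = g {i, k}" "g' {b, c} = g {j, k}"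
    "node_weight g' a = node_weight g i" "node_weight g' b = node_weight g j"
    using transport_triangle[OF T ijk] by metis
  note UU = unique_weights_cong[OF T n]
  note U' = U[unfolded UU]
  have U2: "g' {a, b} \<in> unique_weights n g'" "g' {a, c} \<in> unique_weights n g'"
    using U' t by simp_all
  have sa: "star n g i = star n g' a"
    using star_subset_at_common_node[OF T n ijk t(1-9) U]
      star_subset_at_common_node[OF T[symmetric] n t(1-6) ijk t(7-9)[symmetric] U2] by simp
  have sb: "star n g j = star n g' b"
    using star_subset_at_other_node[OF T n ijk(1,2,4) t(1,2,4,7) U(1)]
      star_subset_at_other_node[OF T[symmetric] n t(1,2,4) ijk(1,2,4) t(7)[symmetric] U2(1)] sa
    by simp
  have "{a, b} = {i', j'}"
    using unique_weightD[OF U'(1)] t ij' g by simp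
  then show ?thesis
    using sa sb t by (auto simp: doubleton_eq_iff node_type_def)
qed

text \<open>
  If the edge is adjacent to no other unique edge in either graph, its ends cannot be told apart, but
  all four stars are the same singleton, and any triangle on the edge shows the two node weights.
  This is why the conclusion is about unordered pairs of types.
\<close>

lemma edge_types:
  assumes T: "subtriangle_distribution n g = subtriangle_distribution n g'" and n: "n \<ge> 3"
    and ij: "i \<in> {1..n}" "j \<in> {1..n}" "i \<noteq> j"
    and ij': "i' \<in> {1..n}" "j' \<in> {1..n}" "i' \<noteq> j'"
    and g: "g' {i', j'} = g {i, j}"
    and U: "g {i, j} \<in> unique_weights n g"
  shows "{#node_type n g i, node_type n g j#} = {#node_type n g' i', node_type n g' j'#}"
proof -
  note UU = unique_weights_cong[OF T n]
  have U': "g' {i', j'} \<in> unique_weights n g'" using U g UU by simp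
  have g1: "g' {j', i'} = g {j, i}" "g {j, i} \<in> unique_weights n g" "g' {j', i'} \<in> unique_weights n g'"
    using g U U' by (simp_all add: insert_commute)
  define adj where "adj h a b \<longleftrightarrow> (\<exists>k \<in> {1..n} - {a, b}. h {a, k} \<in> unique_weights n h)"
    for h :: "nat set \<Rightarrow> 'a" and a b
  have isolated: "star n h a = {h {a, b}}"
    if "\<not> adj h a b" "h {a, b} \<in> unique_weights n h" "a \<noteq> b" "b \<in> {1..n}" for h a b
  proof (intro equalityI subsetI)
    fix x assume "x \<in> star n h a"
    then obtain k where "k \<in> {1..n}" "k \<noteq> a" "h {a, k} = x" "x \<in> unique_weights n h"
      by (rule starE)
    then show "x \<in> {h {a, b}}"
      using that(1) unfolding adj_def by blast
  next
    fix x assume "x \<in> {h {a, b}}"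
    then show "x \<in> star n h a"
      using starI[of h a b n] that by simp
  qed
  consider "adj g i j" | "adj g j i" | "adj g' i' j'" | "adj g' j' i'"
    | (none) "\<not> adj g i j" "\<not> adj g j i" "\<not> adj g' i' j'" "\<not> adj g' j' i'"
    by blast
  then show ?thesis
  proof cases
    case 1
    then obtain k where "k \<in> {1..n}" "i \<noteq> k" "j \<noteq> k" "g {i, k} \<in> unique_weights n g"
      unfolding adj_def by blast
    then show ?thesis
      using edge_types_if_adjacent_edge[OF T n ij(1,2) _ ij(3) _ _ ij' g U] by simp
  next
    case 2
    then obtain k where "k \<in> {1..n}" "j \<noteq> k" "i \<noteq> k" "g {j, k} \<in> unique_weights n g"
      unfolding adj_def by blast
    then show ?thesis
      using edge_types_if_adjacent_edge[OF T n ij(2,1) _ ij(3)[symmetric] _ _ ij'(2,1)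
          ij'(3)[symmetric] g1(1,2)]
      by (simp add: add_mset_commute)
  next
    case 3
    then obtain k where "k \<in> {1..n}" "i' \<noteq> k" "j' \<noteq> k" "g' {i', k} \<in> unique_weights n g'"
      unfolding adj_def by blast
    then show ?thesis
      using edge_types_if_adjacent_edge[OF T[symmetric] n ij'(1,2) _ ij'(3) _ _ ij g[symmetric] U']
      by simp
  next
    case 4
    then obtain k where "k \<in> {1..n}" "j' \<noteq> k" "i' \<noteq> k" "g' {j', k} \<in> unique_weights n g'"
      unfolding adj_def by blast
    then show ?thesis
      using edge_types_if_adjacent_edge[OF T[symmetric] n ij'(2,1) _ ij'(3)[symmetric] _ _ ij(2,1)
          ij(3)[symmetric] g1(1)[symmetric] g1(3)]
      by (simp add: add_mset_commute)
  next
    case none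
    have stars: "star n g i = {g {i, j}}" "star n g j = {g {i, j}}"
      "star n g' i' = {g {i, j}}" "star n g' j' = {g {i, j}}"
      using isolated[OF none(1) U ij(3,2)] isolated[OF none(2) g1(2) ij(3)[symmetric] ij(1)]
        isolated[OF none(3) U' ij'(3,2)] isolated[OF none(4) g1(3) ij'(3)[symmetric] ij'(1)]
        g g1(1) insert_commute[of j i "{}"] by simp_all
    have "card {i, j} < card {1..n}" using ij n by simp
    then have "\<not> {1..n} \<subseteq> {i, j}"
      by (meson card_mono finite.emptyI finite.insertI leD)
    then obtain k where k: "k \<in> {1..n}" "i \<noteq> k" "j \<noteq> k" by blast
    obtain a b where t: "a \<in> {1..n}" "b \<in> {1..n}" "a \<noteq> b" "g' {a, b} = g {i, j}"
      "node_weight g' a = node_weight g i" "node_weight g' b = node_weight g j"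
      using transport_triangle[OF T ij(1,2) k(1) ij(3) k(2,3)] by metis
    have "{a, b} = {i', j'}"
      using unique_weightD[OF U'] t ij' g by simp
    then have "a = i' \<and> b = j' \<or> a = j' \<and> b = i'"
      by (simp only: doubleton_eq_iff)
    then show ?thesis
      unfolding node_type_def stars using t(5,6) by (elim disjE conjE) (simp_all add: add_mset_commute)
  qed
qed

section \<open>The multiset of node types\<close>

text \<open>A type containing the unique weight \<open>x\<close> can occur only at the two ends of the edge of weight \<open>x\<close>.\<close>

lemma count_node_types_at_edge:
  assumes x: "x \<in> unique_weights n g" and ij: "i \<in> {1..n}" "j \<in> {1..n}" "i \<noteq> j" "g {i, j} = x"
    and S: "x \<in> S"
  shows "count (image_mset (node_type n g) (mset_set {1..n})) (S, w) =
    count {#node_type n g i, node_type n g j#} (S, w)"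
proof -
  have "node_type n g k \<noteq> (S, w)" if k: "k \<in> {1..n} - {i, j}" for k
  proof
    assume "node_type n g k = (S, w)"
    then obtain l where "l \<in> {1..n}" "l \<noteq> k" "g {k, l} = x"
      using S by (metis Pair_inject node_type_def starE)
    then have "{k, l} = {i, j}"
      using unique_weightD[OF x] k ij by simp
    then show False using k by auto
  qed
  then have 0: "count (image_mset (node_type n g) (mset_set ({1..n} - {i, j}))) (S, w) = 0"
    unfolding count_eq_zero_iff by fastforce
  have "{1..n} = insert i (insert j ({1..n} - {i, j}))" using ij by auto
  then have "mset_set {1..n} = mset_set (insert i (insert j ({1..n} - {i, j})))" by (rule arg_cong)
  also have "\<dots> = {#i, j#} + mset_set ({1..n} - {i, j})" using ij by simp
  finally show ?thesis using 0 by simp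
qed

text \<open>
  The pairs with first component \<open>a\<close> are known from their second components, and these are what the
  other pairs leave over from all second components. With \<open>a = {}\<close> this supplies the types of the
  nodes on no unique edge from the multiset of all node weights.
\<close>

lemma mset_pairs_eqI:
  assumes ne: "filter_mset (\<lambda>t. fst t \<noteq> a) M = filter_mset (\<lambda>t. fst t \<noteq> a) M'"
    and snd_eq: "image_mset snd M = image_mset snd M'"
  shows "M = M'"
proof -
  let ?F = "filter_mset (\<lambda>t. fst t = a)" and ?G = "filter_mset (\<lambda>t. fst t \<noteq> a)"
  have split: "N = ?F N + ?G N" for N :: "('a \<times> 'b) multiset"
    by (rule multiset_partition)
  have rebuild: "image_mset (Pair a) (image_mset snd (?F N)) = ?F N" for N :: "('a \<times> 'b) multiset"
    by (induction N) auto
  have snd_split: "image_mset snd (?F N) + image_mset snd (?G N) = image_mset snd N"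
    for N :: "('a \<times> 'b) multiset"
    unfolding image_mset_union[symmetric] split[symmetric] ..
  have "image_mset snd (?F M) + image_mset snd (?G M) = image_mset snd (?F M') + image_mset snd (?G M)"
    using snd_split[of M] snd_split[of M'] unfolding ne snd_eq by (simp only:)
  then have "image_mset snd (?F M) = image_mset snd (?F M')"
    by (simp only: add_right_cancel)
  then have "image_mset (Pair a) (image_mset snd (?F M)) = image_mset (Pair a) (image_mset snd (?F M'))"
    by (rule arg_cong)
  then have F: "?F M = ?F M'"
    unfolding rebuild .
  have "M = ?F M + ?G M" by (rule split)
  also have "\<dots> = ?F M' + ?G M'" unfolding F ne ..
  also have "\<dots> = M'" by (rule split[symmetric])
  finally show ?thesis .
qed

lemma node_types_cong:
  assumes T: "subtriangle_distribution n g = subtriangle_distribution n g'" and n: "n \<ge> 3"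
  shows "image_mset (node_type n g) (mset_set {1..n}) = image_mset (node_type n g') (mset_set {1..n})"
    (is "?M = ?M'")
proof -
  note UU = unique_weights_cong[OF T n]
  have nonempty: "count ?M (S, w) = count ?M' (S, w)" if "S \<noteq> {}" for S w
  proof (cases "S \<subseteq> unique_weights n g")
    case True
    with \<open>S \<noteq> {}\<close> obtain x where x: "x \<in> S" "x \<in> unique_weights n g" by auto
    then have x': "x \<in> unique_weights n g'" using UU by simp
    obtain i j where ij: "i \<in> {1..n}" "j \<in> {1..n}" "i \<noteq> j" "g {i, j} = x"
      using unique_weight_edgeE[OF x(2)] .
    obtain i' j' where ij': "i' \<in> {1..n}" "j' \<in> {1..n}" "i' \<noteq> j'" "g' {i', j'} = x"
      using unique_weight_edgeE[OF x'] .
    have "{#node_type n g i, node_type n g j#} = {#node_type n g' i', node_type n g' j'#}"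
      using edge_types[OF T n, of i j i' j'] ij ij' x by simp
    then show ?thesis
      using count_node_types_at_edge[OF x(2) ij x(1)] count_node_types_at_edge[OF x' ij' x(1)] by simp
  next
    case False
    then have "(S, w) \<notin># ?M" "(S, w) \<notin># ?M'"
      using UU by (auto simp: node_type_def star_def)
    then show ?thesis unfolding not_in_iff by (simp only:)
  qed
  have ne: "filter_mset (\<lambda>t. fst t \<noteq> {}) ?M = filter_mset (\<lambda>t. fst t \<noteq> {}) ?M'"
  proof (rule multiset_eqI)
    fix t
    show "count (filter_mset (\<lambda>t. fst t \<noteq> {}) ?M) t = count (filter_mset (\<lambda>t. fst t \<noteq> {}) ?M') t"
      using nonempty[of "fst t" "snd t"] by (simp only: count_filter_mset prod.collapse split: if_split) simp
  qed
  have snd_eq: "image_mset snd ?M = image_mset snd ?M'"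
    using node_weights_cong[OF T n]
    by (simp add: node_weights_def node_type_def image_mset.compositionality o_def)
  show ?thesis
    using ne snd_eq by (rule mset_pairs_eqI)
qed

section \<open>From node types to an isomorphism\<close>

text \<open>
  Where \<open>f'\<close> takes the value \<open>z\<close>, so does \<open>f\<close>; as both take it equally often on the finite set
  \<open>A\<close>, they take it at the same places.
\<close>

lemma image_mset_eq_imp_eq_on:
  assumes fin: "finite A" and eq: "image_mset f (mset_set A) = image_mset f' (mset_set A)"
    and agree: "\<And>a. a \<in> A \<Longrightarrow> f a \<noteq> z \<Longrightarrow> f' a = f a"
    and a: "a \<in> A"
  shows "f' a = f a"
proof -
  have "card (f -` {z} \<inter> A) = card (f' -` {z} \<inter> A)"
    using arg_cong[OF eq, of "\<lambda>M. count M z"] fin by (simp add: count_image_mset)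
  moreover have "f' -` {z} \<inter> A \<subseteq> f -` {z} \<inter> A"
    using agree by force
  ultimately have "f' -` {z} \<inter> A = f -` {z} \<inter> A"
    using fin by (metis card_subset_eq finite_Int)
  then show ?thesis using agree a by fastforce
qed

lemma bij_betw_image_edges:
  assumes "p permutes {1..n}"
  shows "bij_betw ((`) p) (edges n) (edges n)"
proof (rule bij_betwI[where g = "(`) (inv p)"])
  have *: "q ` S \<in> edges n" if "q permutes {1..n}" "S \<in> edges n" for q S
    using that permutes_image[OF that(1)] card_image[OF inj_on_subset[OF permutes_inj[OF that(1)]], of S]
    by (auto simp: edges_eq_card_2)
  show "(`) p \<in> edges n \<rightarrow> edges n" "(`) (inv p) \<in> edges n \<rightarrow> edges n"
    using * assms permutes_inv[OF assms] by auto
  show "inv p ` p ` S = S" "p ` inv p ` S = S" for S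
    using permutes_inverses[OF assms] by (simp_all add: image_image)
qed

text \<open>
  The weight of the edge \<open>{p i, p j}\<close> lies in the stars of both its ends, hence in those of \<open>i\<close> and
  \<open>j\<close> in \<open>g'\<close>; the only edge of \<open>g'\<close> with this weight thus contains \<open>i\<close> and \<open>j\<close>.
\<close>

lemma unique_weight_at_matched_nodes:
  assumes T: "subtriangle_distribution n g = subtriangle_distribution n g'" and n: "n \<ge> 3"
    and p: "p permutes {1..n}"
    and star: "\<And>i. i \<in> {1..n} \<Longrightarrow> star n g' i = star n g (p i)"
    and ij: "i \<in> {1..n}" "j \<in> {1..n}" "i \<noteq> j"
    and U: "g {p i, p j} \<in> unique_weights n g"
  shows "g' {i, j} = g {p i, p j}"
proof -
  let ?x = "g {p i, p j}"
  have pij: "p i \<in> {1..n}" "p j \<in> {1..n}" "p i \<noteq> p j"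
    using ij permutes_in_image[OF p] inj_eq[OF permutes_inj[OF p]] by auto
  have U': "?x \<in> unique_weights n g'" using U unique_weights_cong[OF T n] by simp
  have "?x \<in> star n g' i"
    using starI[OF U] pij star ij by simp
  moreover have "?x \<in> star n g' j"
    using starI[of g "p j" "p i" n] U pij star ij by (simp add: insert_commute)
  ultimately obtain a b where ab: "a \<in> {1..n}" "a \<noteq> i" "g' {i, a} = ?x" "b \<in> {1..n}" "b \<noteq> j" "g' {j, b} = ?x"
    by (metis starE)
  have "{i, a} = {j, b}"
    using unique_weightD[OF U'] ab ij by simp
  then have "a = j" using ij by (auto simp: doubleton_eq_iff)
  then show ?thesis using ab by simp
qed

text \<open>
  A copy of the triangle \<open>{p i, p j, p k}\<close> has two sides of unique weight, and these lie on
  \<open>{i, k}\<close> and \<open>{j, k}\<close> by the preceding lemma; so the third side is \<open>{i, j}\<close>.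
\<close>

lemma closing_edge_at_matched_nodes:
  assumes T: "subtriangle_distribution n g = subtriangle_distribution n g'" and n: "n \<ge> 3"
    and p: "p permutes {1..n}"
    and star: "\<And>i. i \<in> {1..n} \<Longrightarrow> star n g' i = star n g (p i)"
    and ijk: "i \<in> {1..n}" "j \<in> {1..n}" "k \<in> {1..n}" "i \<noteq> j" "i \<noteq> k" "j \<noteq> k"
    and U: "g {p i, p k} \<in> unique_weights n g" "g {p j, p k} \<in> unique_weights n g"
  shows "g' {i, j} = g {p i, p j}"
proof -
  have pij: "p i \<in> {1..n}" "p j \<in> {1..n}" "p k \<in> {1..n}" "p i \<noteq> p j" "p i \<noteq> p k" "p j \<noteq> p k"
    using ijk permutes_in_image[OF p] inj_eq[OF permutes_inj[OF p]] by auto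
  have g: "g' {i, k} = g {p i, p k}" "g' {j, k} = g {p j, p k}"
    using unique_weight_at_matched_nodes[OF T n p star ijk(1,3,5) U(1)]
      unique_weight_at_matched_nodes[OF T n p star ijk(2,3,6) U(2)] by simp_all
  note U' = U[unfolded unique_weights_cong[OF T n]]
  obtain a b c where t: "a \<in> {1..n}" "b \<in> {1..n}" "c \<in> {1..n}" "a \<noteq> b" "a \<noteq> c" "b \<noteq> c"
    "g' {a, b} = g {p i, p j}" "g' {a, c} = g {p i, p k}" "g' {b, c} = g {p j, p k}"
    using transport_triangle[OF T pij] by metis
  have "{a, c} = {i, k}" "{b, c} = {j, k}"
    using unique_weightD[OF U'(1)] unique_weightD[OF U'(2)] t ijk g by simp_all
  then have "{a, b} = {i, j}"
    using t ijk by (auto simp: doubleton_eq_iff)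
  then show ?thesis using t by simp
qed

theorem theorem2p3:
  fixes n :: nat and X :: "'a set" and z :: 'a and g :: "nat set \<Rightarrow> 'a"
  assumes "z \<in> X"
    and "n \<ge> 3"
    and "g \<in> weighted_graphs n X"
    and "\<And>i j. {i, j} \<in> edges n \<Longrightarrow>
           {i, j} \<in> unique_edges n g
         \<or> (\<exists>k \<in> {1..n} - {i, j}. {i, k} \<in> unique_edges n g \<and> {j, k} \<in> unique_edges n g)
         \<or> g {i, j} = z"
  shows "reconstructible n X g"
  unfolding reconstructible_def
proof (intro ballI impI)
  fix g' assume "subtriangle_distribution n g' = subtriangle_distribution n g"
  then have T: "subtriangle_distribution n g = subtriangle_distribution n g'" by simp
  note n = \<open>n \<ge> 3\<close>
  obtain p where p: "p permutes {1..n}"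
    and type: "\<And>i. i \<in> {1..n} \<Longrightarrow> node_type n g' i = node_type n g (p i)"
    using image_mset_eq_implies_permutes[OF _ node_types_cong[OF T[symmetric] n]] by (metis finite_atLeastAtMost)
  have star: "\<And>i. i \<in> {1..n} \<Longrightarrow> star n g' i = star n g (p i)"
    using type by (simp add: node_type_def)
  have nonzero: "g' S = g (p ` S)" if S: "S \<in> edges n" and nz: "g (p ` S) \<noteq> z" for S
  proof -
    obtain i j where ij: "S = {i, j}" "i \<in> {1..n}" "j \<in> {1..n}" "i \<noteq> j"
      using S by (rule edgeE)
    have "{p i, p j} \<in> edges n"
      using ij permutes_in_image[OF p] inj_eq[OF permutes_inj[OF p]] by auto
    then consider "{p i, p j} \<in> unique_edges n g"
      | k where "k \<in> {1..n} - {p i, p j}" "{p i, k} \<in> unique_edges n g" "{p j, k} \<in> unique_edges n g"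
      using assms(4)[of "p i" "p j"] nz unfolding ij(1) image_insert image_empty by blast
    then show ?thesis
    proof cases
      case 1
      then show ?thesis
        using unique_weight_at_matched_nodes[OF T n p star ij(2-4) unique_edge_weight] ij(1) by simp
    next
      case (2 k)
      obtain m where m: "k = p m" using permutes_surj[OF p] by (metis surjD)
      then have m': "m \<in> {1..n}" "i \<noteq> m" "j \<noteq> m"
        using 2(1) permutes_in_image[OF p] by auto
      show ?thesis
        using closing_edge_at_matched_nodes[OF T n p star ij(2,3) m'(1) ij(4) m'(2,3)
            2(2,3)[unfolded m, THEN unique_edge_weight]] ij(1) by simp
    qed
  qed
  have "image_mset ((`) p) (mset_set (edges n)) = mset_set (edges n)"
    using bij_betw_image_edges[OF p] by (simp add: bij_betw_def image_mset_mset_set)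
  then have "image_mset (\<lambda>S. g (p ` S)) (mset_set (edges n)) = edge_weights n g"
    unfolding edge_weights_def image_mset.compositionality[of g "(`) p", unfolded o_def, symmetric]
    by (rule arg_cong)
  also have "\<dots> = image_mset g' (mset_set (edges n))"
    using edge_weights_cong[OF T n] by (simp add: edge_weights_def)
  finally have multisets: "image_mset (\<lambda>S. g (p ` S)) (mset_set (edges n)) =
      image_mset g' (mset_set (edges n))" .
  have edge: "g' S = g (p ` S)" if "S \<in> edges n" for S
    by (rule image_mset_eq_imp_eq_on[where z = z, OF finite_edges multisets nonzero that])
  have "g' {i, j} = g {p i, p j}" if ij: "i \<in> {1..n}" "j \<in> {1..n}" for i j
  proof (cases "i = j")
    case True
    then show ?thesis
      using type[OF ij(1)] by (simp add: node_type_def node_weight_def)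
  next
    case False
    then show ?thesis using edge[of "{i, j}"] ij by simp
  qed
  then show "isomorphic n g g'"
    unfolding isomorphic_def using p by blast
qed

end
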